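(* Let $\{x_n\}$ be a sequence of real numbers converging to $\alpha\in\mathbb{R}$, generated by a one-point iterative method with memory for a nonlinear equation $f(x)=0$ with root $\alpha$. Let $e_n=x_n-\alpha$, with $e_n\neq 0$, and suppose that $$|e_{n+1}| = |C|\,|e_n|^{\rho}\,\bigl(1+O(|e_n|^{\sigma})\bigr)\qquad (n\to\infty),$$ where $C\neq 0$ is a real constant, $0<\sigma<1$ and $\rho\ge (1+\sqrt5)/2$ (so $\rho$ is the order of convergence). Let $$\widetilde{\alpha}_n=x_n-\frac{(x_n-x_{n-1})^2}{x_n-2x_{n-1}+x_{n-2}},\qquad \widetilde{e}_n=x_n-\widetilde{\alpha}_n,$$ and let $$\widetilde{\lambda}_n=\frac{\log|\widetilde{e}_n|}{\log|\widetilde{e}_{n-1}|}$$ be the extrapolated computational local order of convergence (ECLOC). Then $$\widetilde{\lambda}_n\approx\rho\left(1+\frac{\log|C|}{(2\rho-1)\,\log|e_{n-2}|}\right).$$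
   Context: A one-point iterative method with memory for solving $f(x)=0$, where $f:I\subseteq\mathbb{R}\to\mathbb{R}$ and $I$ is a neighborhood of the root $\alpha$, is an iteration $x_{n+1}=\phi(x_n;x_{n-1},\dots,x_{n-j})$, $n\ge 0$, where $\phi$ is the iteration function; the case without memory ($j=0$) is allowed. The quantities $\widetilde{\alpha}_n,\widetilde e_n,\widetilde\lambda_n$ are considered for iterates near the root, i.e. for $n$ large enough. The notation $a_n\approx b_n$ means $\lim_{n\to\infty} a_n/b_n=1$. *)

theory Defs
  imports "HOL-Analysis.Analysis" "HOL-Library.Landau_Symbols"
begin

(* phi (x n) [x (n - 1), ..., x (n - j)]; j = 0 is the case without memory.  The starting values
   x_{-j}, ..., x_0 of the literature are x 0, ..., x j here, hence the guard n \<ge> j. *)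
definition one_point_iteration ::
    "(real \<Rightarrow> real list \<Rightarrow> real) \<Rightarrow> nat \<Rightarrow> (nat \<Rightarrow> real) \<Rightarrow> bool" where
  "one_point_iteration \<phi> j x \<longleftrightarrow>
     (\<forall>n\<ge>j. x (n + 1) = \<phi> (x n) (map (\<lambda>i. x (n - i)) [1..<j + 1]))"

(* The indices n - 1 and n - 2 are truncated for small n, so the following values are
   meaningful for n \<ge> 2 only (ecloc: n \<ge> 3); they are only used as n tends to infinity. *)

definition aitken :: "(nat \<Rightarrow> real) \<Rightarrow> nat \<Rightarrow> real" where
  "aitken x n = x n - (x n - x (n - 1))^2 / (x n - 2 * x (n - 1) + x (n - 2))"

definition aitken_error :: "(nat \<Rightarrow> real) \<Rightarrow> nat \<Rightarrow> real" where
  "aitken_error x n = x n - aitken x n"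

definition ecloc :: "(nat \<Rightarrow> real) \<Rightarrow> nat \<Rightarrow> real" where
  "ecloc x n = ln \<bar>aitken_error x n\<bar> / ln \<bar>aitken_error x (n - 1)\<bar>"

end

theory Submission
  imports Defs
begin

text \<open>
  The correction term in the claim is invisible to the limit: \<open>ln \<bar>e (n - 2)\<bar>\<close> tends to
  \<open>-\<infinity>\<close>, so the whole claim amounts to \<open>ecloc x \<longlonglongrightarrow> \<rho>\<close>.  Since \<open>\<bar>e n\<bar> powr \<sigma>\<close>
  tends to \<open>0\<close>, the error equation yields
  \<open>\<bar>e (n + 1)\<bar> / \<bar>e n\<bar> powr \<rho> \<longlonglongrightarrow> \<bar>C\<bar>\<close>, and the golden ratio, hence \<open>\<rho>\<close>, exceeds \<open>1\<close>.

  This asymptotic law gives superlinear convergence, \<open>e (n + 1) / e n \<longlonglongrightarrow> 0\<close>, and, after taking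
  logarithms, \<open>ln \<bar>e (n + 1)\<bar> / ln \<bar>e n\<bar> \<longlonglongrightarrow> \<rho>\<close>.  Superlinearity makes the largest
  error dominate each difference in Aitken's formula, so the extrapolated error of index \<open>n + 2\<close> is
  asymptotic to \<open>(e (n + 1))\<^sup>2 / e n\<close>.  Its logarithm is therefore
  \<open>2 ln \<bar>e (n + 1)\<bar> - ln \<bar>e n\<bar>\<close> up to \<open>o(1)\<close>, which is asymptotic to
  \<open>(2 \<rho> - 1) ln \<bar>e n\<bar>\<close>.  In the quotient of two consecutive such logarithms the
  factor \<open>2 \<rho> - 1\<close> cancels, and the quotient of the \<open>ln \<bar>e n\<bar>\<close> leaves \<open>\<rho>\<close>.
\<close>

lemma ln_abs_at_bot:
  fixes e :: "nat \<Rightarrow> real"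
  assumes "e \<longlonglongrightarrow> 0" and "\<And>n. e n \<noteq> 0"
  shows "filterlim (\<lambda>n. ln \<bar>e n\<bar>) at_bot sequentially"
proof -
  have "filterlim (\<lambda>n. \<bar>e n\<bar>) (at_right 0) sequentially"
    using assms by (auto simp: filterlim_at tendsto_rabs_zero)
  then show ?thesis
    by (rule filterlim_compose[OF ln_at_0])
qed

lemma convergent_over_at_bot:
  fixes a b :: "nat \<Rightarrow> real"
  assumes "a \<longlonglongrightarrow> l" and "filterlim b at_bot sequentially"
  shows "(\<lambda>n. a n / b n) \<longlonglongrightarrow> 0"
  by (rule tendsto_divide_0[OF assms(1) filterlim_mono[OF assms(2) at_bot_le_at_infinity order_refl]])

lemma superlinear_of_order_gt_1:
  fixes e :: "nat \<Rightarrow> real"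
  assumes lim: "e \<longlonglongrightarrow> 0" and nz: "\<And>n. e n \<noteq> 0" and "\<rho> > 1"
    and order: "(\<lambda>n. \<bar>e (Suc n)\<bar> / \<bar>e n\<bar> powr \<rho>) \<longlonglongrightarrow> K"
  shows "(\<lambda>n. e (Suc n) / e n) \<longlonglongrightarrow> 0"
proof -
  have "(\<lambda>n. \<bar>e n\<bar> powr (\<rho> - 1)) \<longlonglongrightarrow> 0"
    by (rule tendsto_zero_powrI[OF tendsto_rabs_zero[OF lim] tendsto_const])
       (use \<open>\<rho> > 1\<close> in auto)
  with order have "(\<lambda>n. \<bar>e (Suc n)\<bar> / \<bar>e n\<bar> powr \<rho> * \<bar>e n\<bar> powr (\<rho> - 1)) \<longlonglongrightarrow> 0"
    using tendsto_mult by fastforce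
  moreover have "\<bar>e (Suc n)\<bar> / \<bar>e n\<bar> powr \<rho> * \<bar>e n\<bar> powr (\<rho> - 1) = \<bar>e (Suc n) / e n\<bar>" for n
    using nz[of n] by (simp add: powr_diff)
  ultimately show ?thesis
    using tendsto_rabs_zero_cancel by (simp only:)
qed

text \<open>Taking logarithms turns the power law into \<open>ln \<bar>e (n + 1)\<bar> = \<rho> ln \<bar>e n\<bar> + O(1)\<close>,
  and the bounded term disappears against \<open>ln \<bar>e n\<bar>\<close>.\<close>

lemma ln_error_ratio:
  fixes e :: "nat \<Rightarrow> real"
  assumes lim: "e \<longlonglongrightarrow> 0" and nz: "\<And>n. e n \<noteq> 0"
    and order: "(\<lambda>n. \<bar>e (Suc n)\<bar> / \<bar>e n\<bar> powr \<rho>) \<longlonglongrightarrow> K" and "K \<noteq> 0"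
  shows "(\<lambda>n. ln \<bar>e (Suc n)\<bar> / ln \<bar>e n\<bar>) \<longlonglongrightarrow> \<rho>"
proof -
  let ?q = "\<lambda>n. \<bar>e (Suc n)\<bar> / \<bar>e n\<bar> powr \<rho>"
  note bot = ln_abs_at_bot[OF lim nz]
  have "(\<lambda>n. ln (?q n) / ln \<bar>e n\<bar>) \<longlonglongrightarrow> 0"
    by (rule convergent_over_at_bot[OF tendsto_ln[OF order \<open>K \<noteq> 0\<close>] bot])
  then have "(\<lambda>n. \<rho> + ln (?q n) / ln \<bar>e n\<bar>) \<longlonglongrightarrow> \<rho> + 0"
    by (intro tendsto_intros)
  moreover have "\<forall>\<^sub>F n in sequentially. \<rho> + ln (?q n) / ln \<bar>e n\<bar> = ln \<bar>e (Suc n)\<bar> / ln \<bar>e n\<bar>"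
    using filterlim_at_bot_dense[THEN iffD1, OF bot, rule_format, of 0]
  proof eventually_elim
    case (elim n)
    have "ln (?q n) = ln \<bar>e (Suc n)\<bar> - (\<rho> * ln \<bar>e n\<bar>)"
      using nz[of n] nz[of "Suc n"] by (simp add: ln_div)
    with elim show ?case
      by (simp add: field_simps)
  qed
  ultimately show ?thesis
    by (simp add: Lim_transform_eventually)
qed

text \<open>Aitken's formula is invariant under translation, so iterates may be replaced by errors.
  Dividing the differences \<open>e (n + 2) - e (n + 1)\<close> and \<open>e (n + 2) - 2 e (n + 1) + e n\<close> by their
  dominant terms \<open>- e (n + 1)\<close> and \<open>e n\<close> leaves expressions in the ratios \<open>e (n + 1) / e n\<close>
  that tend to \<open>1\<close>.\<close>

lemma aitken_error_asymp:
  fixes x e :: "nat \<Rightarrow> real"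
  assumes e_def: "\<And>n. e n = x n - \<alpha>" and nz: "\<And>n. e n \<noteq> 0"
    and superlinear: "(\<lambda>n. e (Suc n) / e n) \<longlonglongrightarrow> 0"
  shows "(\<lambda>n. aitken_error x (n + 2) / ((e (Suc n))\<^sup>2 / e n)) \<longlonglongrightarrow> 1"
proof -
  define r where "r n = e (Suc n) / e n" for n
  have r: "r \<longlonglongrightarrow> 0" "(\<lambda>n. r (Suc n)) \<longlonglongrightarrow> 0"
    using superlinear LIMSEQ_Suc by (auto simp: r_def[abs_def])
  have "(\<lambda>n. (r (Suc n) - 1)\<^sup>2 / (r (Suc n) * r n - 2 * r n + 1)) \<longlonglongrightarrow> (0 - 1)\<^sup>2 / (0 * 0 - 2 * 0 + 1)"
    by (intro tendsto_intros r) auto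
  moreover have "(r (Suc n) - 1)\<^sup>2 / (r (Suc n) * r n - 2 * r n + 1)
      = aitken_error x (n + 2) / ((e (Suc n))\<^sup>2 / e n)" for n
  proof -
    have "aitken_error x (n + 2)
        = (e (Suc (Suc n)) - e (Suc n))\<^sup>2 / (e (Suc (Suc n)) - 2 * e (Suc n) + e n)"
      by (simp add: aitken_error_def aitken_def e_def)
    moreover have "e (Suc (Suc n)) - e (Suc n) = e (Suc n) * (r (Suc n) - 1)"
      using nz[of "Suc n"] by (simp add: r_def field_simps)
    moreover have "e (Suc (Suc n)) - 2 * e (Suc n) + e n = e n * (r (Suc n) * r n - 2 * r n + 1)"
      using nz[of "Suc n"] nz[of n] by (simp add: r_def field_simps)
    ultimately show ?thesis
      using nz[of "Suc n"] nz[of n] by (simp add: power_mult_distrib)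
  qed
  ultimately show ?thesis
    by simp
qed

text \<open>The constant \<open>2 \<rho> - 1\<close> is the exponent of \<open>\<bar>e n\<bar>\<close> in \<open>(e (n + 1))\<^sup>2 / e n\<close> when
  \<open>e (n + 1)\<close> counts as the \<open>\<rho>\<close>-th power of \<open>e n\<close>.\<close>

lemma ln_aitken_error_ratio:
  fixes x e :: "nat \<Rightarrow> real"
  assumes e_def: "\<And>n. e n = x n - \<alpha>" and lim: "e \<longlonglongrightarrow> 0" and nz: "\<And>n. e n \<noteq> 0"
    and superlinear: "(\<lambda>n. e (Suc n) / e n) \<longlonglongrightarrow> 0"
    and ln_ratio: "(\<lambda>n. ln \<bar>e (Suc n)\<bar> / ln \<bar>e n\<bar>) \<longlonglongrightarrow> \<rho>"
  shows "(\<lambda>n. ln \<bar>aitken_error x (n + 2)\<bar> / ln \<bar>e n\<bar>) \<longlonglongrightarrow> 2 * \<rho> - 1"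
proof -
  define Q where "Q n = aitken_error x (n + 2) / ((e (Suc n))\<^sup>2 / e n)" for n
  note bot = ln_abs_at_bot[OF lim nz]
  have Q: "Q \<longlonglongrightarrow> 1"
    using aitken_error_asymp[OF e_def nz superlinear] by (simp add: Q_def[abs_def])
  have "(\<lambda>n. ln (Q n) / ln \<bar>e n\<bar>) \<longlonglongrightarrow> 0"
    by (rule convergent_over_at_bot[OF tendsto_ln[OF Q one_neq_zero] bot])
  then have "(\<lambda>n. ln (Q n) / ln \<bar>e n\<bar> + (2 * (ln \<bar>e (Suc n)\<bar> / ln \<bar>e n\<bar>) - 1)) \<longlonglongrightarrow> 0 + (2 * \<rho> - 1)"
    by (intro tendsto_intros ln_ratio)
  moreover have "\<forall>\<^sub>F n in sequentially.
      ln (Q n) / ln \<bar>e n\<bar> + (2 * (ln \<bar>e (Suc n)\<bar> / ln \<bar>e n\<bar>) - 1)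
      = ln \<bar>aitken_error x (n + 2)\<bar> / ln \<bar>e n\<bar>"
    using filterlim_at_bot_dense[THEN iffD1, OF bot, rule_format, of 0]
      order_tendstoD(1)[OF Q zero_less_one]
  proof eventually_elim
    case (elim n)
    have "\<bar>aitken_error x (n + 2)\<bar> = Q n * (\<bar>e (Suc n)\<bar>\<^sup>2 / \<bar>e n\<bar>)"
    proof -
      have "aitken_error x (n + 2) = Q n * ((e (Suc n))\<^sup>2 / e n)"
        using nz[of n] nz[of "Suc n"] by (simp add: Q_def)
      with elim show ?thesis
        by (simp add: abs_mult)
    qed
    also have "ln \<dots> = ln (Q n) + ((2 * ln \<bar>e (Suc n)\<bar>) - ln \<bar>e n\<bar>)"
    proof -
      have "ln (q * (a\<^sup>2 / b)) = ln q + (2 * ln a - ln b)" if "q > 0" "a > 0" "b > 0" for q a b :: real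
        using that by (simp add: ln_mult_pos ln_div ln_realpow)
      from this[of "Q n" "\<bar>e (Suc n)\<bar>" "\<bar>e n\<bar>"] show ?thesis
        using elim nz by simp
    qed
    finally show ?case
      using elim by (simp add: field_simps)
  qed
  ultimately show ?thesis
    by (simp add: Lim_transform_eventually)
qed

text \<open>With \<open>R n\<close> the quotient of \<open>ln \<bar>aitken_error x (n + 2)\<bar>\<close> by \<open>ln \<bar>e n\<bar>\<close>, the estimate
  \<open>ecloc x (n + 3)\<close> factors as \<open>R (n + 1) / R n\<close> times the quotient of consecutive
  \<open>ln \<bar>e n\<bar>\<close>.  The first factor tends to \<open>1\<close> because \<open>R\<close> has the nonzero limit \<open>2 \<rho> - 1\<close>.\<close>

lemma ecloc_tendsto_order:
  fixes x e :: "nat \<Rightarrow> real"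
  assumes e_def: "\<And>n. e n = x n - \<alpha>" and lim: "e \<longlonglongrightarrow> 0" and nz: "\<And>n. e n \<noteq> 0"
    and "\<rho> > 1" and "K \<noteq> 0"
    and order: "(\<lambda>n. \<bar>e (Suc n)\<bar> / \<bar>e n\<bar> powr \<rho>) \<longlonglongrightarrow> K"
  shows "ecloc x \<longlonglongrightarrow> \<rho>"
proof -
  define R where "R n = ln \<bar>aitken_error x (n + 2)\<bar> / ln \<bar>e n\<bar>" for n
  note ln_ratio = ln_error_ratio[OF lim nz order \<open>K \<noteq> 0\<close>]
  note bot = ln_abs_at_bot[OF lim nz]
  have R: "R \<longlonglongrightarrow> 2 * \<rho> - 1"
    using ln_aitken_error_ratio[OF e_def lim nz
        superlinear_of_order_gt_1[OF lim nz \<open>\<rho> > 1\<close> order] ln_ratio]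
    by (simp add: R_def[abs_def])
  have "(\<lambda>n. R (Suc n) * (ln \<bar>e (Suc n)\<bar> / ln \<bar>e n\<bar>) / R n) \<longlonglongrightarrow> (2 * \<rho> - 1) * \<rho> / (2 * \<rho> - 1)"
    using \<open>\<rho> > 1\<close> by (intro tendsto_intros R LIMSEQ_Suc ln_ratio) auto
  moreover have "(2 * \<rho> - 1) * \<rho> / (2 * \<rho> - 1) = \<rho>"
    using \<open>\<rho> > 1\<close> by simp
  \<comment> \<open>Both logarithms must be nonzero for the factors \<open>ln \<bar>e n\<bar>\<close> and \<open>ln \<bar>e (Suc n)\<bar>\<close> to cancel.\<close>
  moreover have "\<forall>\<^sub>F n in sequentially.
      R (Suc n) * (ln \<bar>e (Suc n)\<bar> / ln \<bar>e n\<bar>) / R n = ecloc x (n + 3)"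
    using filterlim_at_bot_dense[THEN iffD1, OF bot, rule_format, of 0]
      filterlim_at_bot_dense[THEN iffD1, OF filterlim_compose[OF bot filterlim_Suc], rule_format, of 0]
  proof eventually_elim
    case (elim n)
    then show ?case
      by (simp add: R_def ecloc_def eval_nat_numeral)
  qed
  ultimately have "(\<lambda>n. ecloc x (n + 3)) \<longlonglongrightarrow> \<rho>"
    by (simp add: Lim_transform_eventually)
  then show ?thesis
    by (rule LIMSEQ_offset)
qed

theorem proposition5p1:
  fixes f :: "real \<Rightarrow> real" and I :: "real set"
    and \<phi> :: "real \<Rightarrow> real list \<Rightarrow> real" and j :: nat
    and x e :: "nat \<Rightarrow> real" and \<alpha> C \<rho> \<sigma> :: real
  assumes nbhd: "\<alpha> \<in> interior I"
    and root: "f \<alpha> = 0"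
    and iteration: "one_point_iteration \<phi> j x"
    and convergent: "x \<longlonglongrightarrow> \<alpha>"
    and e_def: "\<And>n. e n = x n - \<alpha>"
    and e_nonzero: "\<And>n. e n \<noteq> 0"
    and C_nonzero: "C \<noteq> 0"
    and sigma: "0 < \<sigma>" "\<sigma> < 1"
    and rho: "\<rho> \<ge> (1 + sqrt 5) / 2"
    and error_eq: "\<exists>\<delta> \<in> O(\<lambda>n. \<bar>e n\<bar> powr \<sigma>). \<forall>\<^sub>F n in sequentially.
          \<bar>e (n + 1)\<bar> = \<bar>C\<bar> * \<bar>e n\<bar> powr \<rho> * (1 + \<delta> n)"
  shows "(\<lambda>n. ecloc x n / (\<rho> * (1 + ln \<bar>C\<bar> / ((2 * \<rho> - 1) * ln \<bar>e (n - 2)\<bar>)))) \<longlonglongrightarrow> 1"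
proof -
  have lim: "e \<longlonglongrightarrow> 0"
    using LIM_zero[OF convergent, folded e_def] .
  have "1 < (1 + sqrt 5) / 2"
    by simp
  then have "\<rho> > 1"
    using rho by (rule less_le_trans)
  have order: "(\<lambda>n. \<bar>e (Suc n)\<bar> / \<bar>e n\<bar> powr \<rho>) \<longlonglongrightarrow> \<bar>C\<bar>"
  proof -
    obtain \<delta> where \<delta>: "\<delta> \<in> O(\<lambda>n. \<bar>e n\<bar> powr \<sigma>)"
      and eq: "\<forall>\<^sub>F n in sequentially. \<bar>e (n + 1)\<bar> = \<bar>C\<bar> * \<bar>e n\<bar> powr \<rho> * (1 + \<delta> n)"
      using error_eq by blast
    have powr: "(\<lambda>n. \<bar>e n\<bar> powr \<sigma>) \<longlonglongrightarrow> 0"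
      by (rule tendsto_zero_powrI[OF tendsto_rabs_zero[OF lim] tendsto_const]) (use sigma in auto)
    obtain c where "\<forall>\<^sub>F n in sequentially. norm (\<delta> n) \<le> c * norm (\<bar>e n\<bar> powr \<sigma>)"
      using \<delta> by (auto elim: landau_o.bigE)
    then have "\<delta> \<longlonglongrightarrow> 0"
      by (rule Lim_null_comparison[OF _ tendsto_mult_right_zero[OF tendsto_norm_zero[OF powr]]])
    then have "(\<lambda>n. \<bar>C\<bar> * (1 + \<delta> n)) \<longlonglongrightarrow> \<bar>C\<bar> * (1 + 0)"
      by (intro tendsto_intros)
    moreover have "\<forall>\<^sub>F n in sequentially. \<bar>C\<bar> * (1 + \<delta> n) = \<bar>e (Suc n)\<bar> / \<bar>e n\<bar> powr \<rho>"
      using eq by eventually_elim (use e_nonzero in simp)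
    ultimately show ?thesis
      by (simp add: Lim_transform_eventually)
  qed
  have ecloc: "ecloc x \<longlonglongrightarrow> \<rho>"
    by (rule ecloc_tendsto_order[OF e_def lim e_nonzero \<open>\<rho> > 1\<close> _ order]) (simp add: C_nonzero)
  have "(\<lambda>n. ln \<bar>C\<bar> / (2 * \<rho> - 1) / ln \<bar>e (n - 2)\<bar>) \<longlonglongrightarrow> 0"
    by (rule convergent_over_at_bot[OF tendsto_const
          filterlim_compose[OF ln_abs_at_bot[OF lim e_nonzero] filterlim_minus_const_nat_at_top]])
  then have "(\<lambda>n. ecloc x n / (\<rho> * (1 + ln \<bar>C\<bar> / (2 * \<rho> - 1) / ln \<bar>e (n - 2)\<bar>))) \<longlonglongrightarrow> \<rho> / (\<rho> * (1 + 0))"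
    using \<open>\<rho> > 1\<close> by (intro tendsto_intros ecloc) auto
  then show ?thesis
    using \<open>\<rho> > 1\<close> by simp
qed

end
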